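(* For all integers $b \geq 2$ and $2 \leq k \leq b$, there exists a connected graph $G$ on $b$ vertices such that $f_d(G,v)=k$ for every starting vertex $v \in V(G)$.
   Context: All graphs are finite and simple; $\mathrm{dist}(u,v)$ denotes the length of a shortest path between $u$ and $v$ in $G$. Explorer-Director game on a connected graph $G$ with starting vertex $v$: a token is initially at $v$ (so $v$ counts as visited). On each turn the Explorer names a distance $d$ such that at least one vertex of $G$ is at distance exactly $d$ from the token's current position, and then the Director moves the token to a vertex of their choice at distance exactly $d$ from the current position. The Explorer wants to maximize, and the Director to minimize, the number of distinct vertices visited by the token; play continues until the Explorer can no longer force the token onto an unvisited vertex. $f_d(G,v)$ is the number of visited vertices at the end of the game under optimal play by both players; equivalently, it is the largest $k$ such that the Explorer has a (possibly adaptive) strategy guaranteeing, against every play of the Director, that at least $k$ distinct vertices (including $v$) are visited after finitely many turns. *)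

theory Defs
  imports "Graph_Theory.Graph_Theory"
begin

(* A finite simple graph is a pair_graph: a finite, loop-free, symmetric set of vertex pairs.
   A path (apath) is given by its list of arcs, so length p is the number of edges of p.
   Between vertices in different components the value is unspecified. *)
definition graph_dist :: "'a pair_pre_digraph \<Rightarrow> 'a \<Rightarrow> 'a \<Rightarrow> nat" where
  "graph_dist G u v = (LEAST n. \<exists>p. pre_digraph.apath (with_proj G) u p v \<and> length p = n)"

(* An Explorer strategy maps the history of token positions (oldest first, current position last)
   to the distance named next.  Distance 0 is not excluded: it is always available and merely
   leaves the token in place. *)
definition explorer_strategy :: "'a pair_pre_digraph \<Rightarrow> ('a list \<Rightarrow> nat) \<Rightarrow> bool" where
  "explorer_strategy G \<sigma> \<longleftrightarrow>
     (\<forall>h. h \<noteq> [] \<and> set h \<subseteq> pverts G \<longrightarrow> (\<exists>u \<in> pverts G. graph_dist G (last h) u = \<sigma> h))"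

(* p n is the token position after n turns; every choice of the Director is allowed.
   Plays are continued forever, which is harmless as only finite prefixes are evaluated below. *)
definition director_play ::
    "'a pair_pre_digraph \<Rightarrow> 'a \<Rightarrow> ('a list \<Rightarrow> nat) \<Rightarrow> (nat \<Rightarrow> 'a) \<Rightarrow> bool" where
  "director_play G v \<sigma> p \<longleftrightarrow>
     p 0 = v \<and>
     (\<forall>n. p (Suc n) \<in> pverts G \<and> graph_dist G (p n) (p (Suc n)) = \<sigma> (map p [0..<Suc n]))"

definition explorer_guarantees :: "'a pair_pre_digraph \<Rightarrow> 'a \<Rightarrow> nat \<Rightarrow> bool" where
  "explorer_guarantees G v k \<longleftrightarrow>
     (\<exists>\<sigma>. explorer_strategy G \<sigma> \<and>
        (\<forall>p. director_play G v \<sigma> p \<longrightarrow> (\<exists>n. k \<le> card (p ` {..n}))))"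

(* The paper's f_d(G,v).  The maximum exists for finite G and v in G, since 1 can be guaranteed
   and nothing above card (pverts G) can. *)
definition f_d :: "'a pair_pre_digraph \<Rightarrow> 'a \<Rightarrow> nat" where
  "f_d G v = (GREATEST k. explorer_guarantees G v k)"

end

theory Submission
  imports Defs
begin

text \<open>
  Take a path on \<open>k\<close> vertices and blow up one of its ends to a clique of \<open>b - k + 1\<close> twins.
  The Director never needs more than one of the twins, so at most \<open>k\<close> vertices are visited.
  Conversely, the Explorer can always force the token to an end of the path by naming the
  eccentricity of the current vertex, from the blown-up end to the other end (unless \<open>k = 2\<close>,
  where two visited vertices come for free), and from there to any vertex of the path,
  up to the choice of a twin.
\<close>

section \<open>Distances\<close>

text \<open>A candidate \<open>D\<close> is certified locally: as \<open>D\<close> drops by at most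
  one along an arc, no walk is shorter than \<open>D u v\<close>, and \<open>descent\<close> builds
  a walk of exactly that length. Existence of the path is kept as a conclusion because connectivity
  needs it too.\<close>

lemma (in pair_wf_digraph) graph_dist_eqI:
  fixes D :: "'a \<Rightarrow> 'a \<Rightarrow> nat"
  assumes refl: "\<And>v. D v v = 0"
    and arc: "\<And>u w v. (u, w) \<in> parcs G \<Longrightarrow> D u v \<le> Suc (D w v)"
    and descent: "\<And>u v. u \<in> pverts G \<Longrightarrow> v \<in> pverts G \<Longrightarrow> u \<noteq> v \<Longrightarrow>
      \<exists>w. (u, w) \<in> parcs G \<and> D u v = Suc (D w v)"
    and u: "u \<in> pverts G" and v: "v \<in> pverts G"
  shows "\<exists>p. apath u p v" and "graph_dist G u v = D u v"
proof -
  have lower: "D u v \<le> length p" if "awalk u p v" for p u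
    using that
  proof (induction p arbitrary: u)
    case Nil
    then show ?case using refl by (simp add: awalk_Nil_iff)
  next
    case (Cons e p)
    then have "e \<in> parcs G" "fst e = u" "awalk (snd e) p v"
      by (auto simp: awalk_Cons_iff)
    then show ?case
      using Cons.IH[of "snd e"] arc[of u "snd e" v] by (cases e) auto
  qed
  \<comment> \<open>The bound on \<open>D\<close> along the path strengthens the induction: the next
    start lies strictly higher, so it is not repeated and the walk remains a path.\<close>
  have upper: "\<exists>p. apath u p v \<and> length p = D u v \<and> (\<forall>w \<in> set (pawalk_verts u p). D w v \<le> D u v)"
    using u
  proof (induction "D u v" arbitrary: u)
    case 0
    then have "u = v" using descent[OF _ v] by fastforce
    with 0 show ?case by (intro exI[of _ "[]"]) (auto simp: apath_Nil_iff)
  next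
    case (Suc n)
    then have "u \<noteq> v" using refl by auto
    then obtain w where w: "(u, w) \<in> parcs G" "D u v = Suc (D w v)"
      using descent[OF Suc.prems v] by blast
    then obtain p where p: "apath w p v" "length p = D w v"
        "\<forall>x \<in> set (pawalk_verts w p). D x v \<le> D w v"
      using Suc.hyps in_arcsD2 by (metis Suc_inject)
    then have "u \<notin> set (pawalk_verts w p)" using w(2) by force
    then have "apath u ((u, w) # p) v" using w(1) p(1) by (simp add: apath_Cons_iff)
    with p w(2) show ?case by (intro exI[of _ "(u, w) # p"]) force
  qed
  then show "\<exists>p. apath u p v" by blast
  show "graph_dist G u v = D u v"
    unfolding graph_dist_def
  proof (rule Least_equality)
    show "\<exists>p. apath u p v \<and> length p = D u v" using upper by blast
  next
    fix n assume "\<exists>p. apath u p v \<and> length p = n"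
    then show "D u v \<le> n" using lower awalkI_apath by blast
  qed
qed

section \<open>Strategies of both players\<close>

text \<open>If a play never reached \<open>k\<close> vertices, its histories would form an infinite
  descending chain under \<open>\<mu>\<close>. The measure may depend on the whole history, so it
  can count what is still unvisited.\<close>

lemma explorer_guaranteesI:
  fixes \<mu> :: "'a list \<Rightarrow> nat"
  assumes strat: "explorer_strategy G \<sigma>" and v: "v \<in> pverts G"
    and step: "\<And>h u. h \<noteq> [] \<Longrightarrow> set h \<subseteq> pverts G \<Longrightarrow> u \<in> pverts G \<Longrightarrow>
      graph_dist G (last h) u = \<sigma> h \<Longrightarrow> card (set (h @ [u])) < k \<Longrightarrow> \<mu> (h @ [u]) < \<mu> h"
  shows "explorer_guarantees G v k"
  unfolding explorer_guarantees_def
proof (intro exI[of _ \<sigma>] conjI strat allI impI, rule ccontr)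
  fix p assume play: "director_play G v \<sigma> p" and "\<not> (\<exists>n. k \<le> card (p ` {..n}))"
  then have few: "card (p ` {..n}) < k" for n by (auto simp: not_le)
  define h where "h n = map p [0..<Suc n]" for n
  have in_verts: "p n \<in> pverts G" for n
    using play v by (cases n) (auto simp: director_play_def)
  have set_h: "set (h n) = p ` {..n}" for n
    by (auto simp: h_def atLeast0LessThan lessThan_Suc_atMost simp del: upt_Suc)
  have "\<mu> (h (Suc n)) < \<mu> (h n)" for n
  proof -
    have eq: "h (Suc n) = h n @ [p (Suc n)]" by (simp add: h_def)
    have "\<mu> (h n @ [p (Suc n)]) < \<mu> (h n)"
    proof (rule step)
      show "h n \<noteq> []" by (simp add: h_def)
      show "set (h n) \<subseteq> pverts G" using in_verts by (auto simp: set_h)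
      show "p (Suc n) \<in> pverts G" by (rule in_verts)
      show "graph_dist G (last (h n)) (p (Suc n)) = \<sigma> (h n)"
        using play by (simp add: director_play_def h_def)
      show "card (set (h n @ [p (Suc n)])) < k" using few[of "Suc n"] by (simp add: set_h flip: eq)
    qed
    then show ?thesis by (simp add: eq)
  qed
  then show False
    using wf_less_than unfolding wf_iff_no_infinite_down_chain less_than_iff
    by (elim notE) (rule exI[of _ "\<lambda>n. \<mu> (h n)"], blast)
qed

text \<open>The Director confines the token to \<open>S\<close>, since any distance available at a
  vertex of \<open>S\<close> is also realised inside \<open>S\<close>.\<close>

lemma explorer_guarantees_le_card:
  assumes guar: "explorer_guarantees G v k"
    and S: "finite S" "S \<subseteq> pverts G" "v \<in> S"
    and closed: "\<And>s u. s \<in> S \<Longrightarrow> u \<in> pverts G \<Longrightarrow> \<exists>u' \<in> S. graph_dist G s u' = graph_dist G s u"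
  shows "k \<le> card S"
proof -
  obtain \<sigma> where strat: "explorer_strategy G \<sigma>"
    and wins: "\<And>p. director_play G v \<sigma> p \<Longrightarrow> \<exists>n. k \<le> card (p ` {..n})"
    using guar by (auto simp: explorer_guarantees_def)
  \<comment> \<open>Dependent choice on histories rather than positions, because
    \<open>\<sigma>\<close> reads the whole history; the clause for \<open>n = 0\<close> fixes the
    start.\<close>
  define P where "P n h \<longleftrightarrow> h \<noteq> [] \<and> set h \<subseteq> S \<and> (n = 0 \<longrightarrow> h = [v])" for n :: nat and h
  define Q where "Q n h h' \<longleftrightarrow> (\<exists>u. h' = h @ [u] \<and> graph_dist G (last h) u = \<sigma> h)"
    for n :: nat and h h'
  have "\<exists>h'. P (Suc n) h' \<and> Q n h h'" if "P n h" for n h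
  proof -
    have h: "h \<noteq> []" "set h \<subseteq> S" using that by (auto simp: P_def)
    then obtain u where "u \<in> pverts G" "graph_dist G (last h) u = \<sigma> h"
      using strat S(2) unfolding explorer_strategy_def by blast
    moreover have "last h \<in> S" using h by auto
    ultimately obtain u' where "u' \<in> S" "graph_dist G (last h) u' = \<sigma> h"
      using closed by metis
    then have "P (Suc n) (h @ [u'])" "Q n h (h @ [u'])" using h by (auto simp: P_def Q_def)
    then show ?thesis by blast
  qed
  moreover have "\<exists>h. P 0 h" using S(3) by (auto simp: P_def)
  ultimately obtain H where H: "\<And>n. P n (H n)" "\<And>n. Q n (H n) (H (Suc n))"
    using dependent_nat_choice[of P Q] by metis
  define p where "p n = last (H n)" for n
  have H_Suc: "H (Suc n) = H n @ [p (Suc n)]"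
    and dist: "graph_dist G (p n) (p (Suc n)) = \<sigma> (H n)" for n
    using H(2)[of n] by (auto simp: Q_def p_def)
  have hist: "H n = map p [0..<Suc n]" for n
  proof (induction n)
    case 0
    then show ?case using H(1)[of 0] by (simp add: P_def p_def)
  next
    case (Suc n)
    then show ?case by (simp add: H_Suc)
  qed
  have in_S: "p n \<in> S" for n
    using H(1)[of n] by (auto simp: P_def p_def)
  have "director_play G v \<sigma> p"
    unfolding director_play_def
  proof (intro conjI allI)
    show "p 0 = v" using H(1)[of 0] by (simp add: P_def p_def)
    show "p (Suc n) \<in> pverts G" for n using in_S S(2) by blast
    show "graph_dist G (p n) (p (Suc n)) = \<sigma> (map p [0..<Suc n])" for n
      using dist[of n] hist[of n] by metis
  qed
  then obtain n where "k \<le> card (p ` {..n})" using wins by blast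
  also have "\<dots> \<le> card S" using in_S S(1) by (intro card_mono) auto
  finally show ?thesis .
qed

section \<open>A path with one end blown up to a clique\<close>

text \<open>The path is \<open>0, \<dots>, m\<close>, and the vertices from \<open>m\<close> on are the twins.\<close>

definition kite :: "nat \<Rightarrow> nat \<Rightarrow> nat pair_pre_digraph" where
  "kite m b = \<lparr>pverts = {..<b},
     parcs = {(i, j). i < b \<and> j < b \<and> i \<noteq> j \<and> min i m \<le> Suc (min j m) \<and> min j m \<le> Suc (min i m)}\<rparr>"

text \<open>Here \<open>min i m\<close> projects all twins to the end \<open>m\<close> of the path.
  The two truncated differences give an absolute value, and \<open>max 1\<close> is for distinct
  twins, whose projections coincide.\<close>

definition kite_dist :: "nat \<Rightarrow> nat \<Rightarrow> nat \<Rightarrow> nat" where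
  "kite_dist m i j =
     (if i = j then 0 else max 1 (max (min i m - min j m) (min j m - min i m)))"

lemma pverts_kite [simp]: "pverts (kite m b) = {..<b}"
  by (simp add: kite_def)

lemma pair_graph_kite: "pair_graph (kite m b)"
proof
  show "finite (parcs (kite m b))"
    by (rule finite_subset[of _ "{..<b} \<times> {..<b}"]) (auto simp: kite_def)
  show "symmetric (with_proj (kite m b))"
    by (auto simp: symmetric_def kite_def intro!: symI)
qed (auto simp: kite_def)

lemma
  assumes "i < b" "j < b" "m < b"
  shows kite_apath: "\<exists>p. pre_digraph.apath (with_proj (kite m b)) i p j"
    and graph_dist_kite: "graph_dist (kite m b) i j = kite_dist m i j"
proof -
  interpret pair_graph "kite m b" by (rule pair_graph_kite)
  have refl: "kite_dist m v v = 0" for v by (simp add: kite_dist_def)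
  have arc: "kite_dist m u v \<le> Suc (kite_dist m w v)" if "(u, w) \<in> parcs (kite m b)" for u w v
  proof -
    have step: "min u m \<le> Suc (min w m)" "min w m \<le> Suc (min u m)"
      using that by (simp_all add: kite_def)
    have "max 1 (max (a - c) (c - a)) \<le> Suc (max 1 (max (b - c) (c - b)))"
      if "a \<le> Suc b" "b \<le> Suc a" for a b c :: nat
      using that by linarith
    from this[OF step, of "min v m"] show ?thesis
      \<comment> \<open>For \<open>w = v\<close> the distance is 0, so the formula with
        \<open>max 1\<close> does not describe it.\<close>
      using step by (cases "w = v") (auto simp: kite_dist_def le_diff_conv)
  qed
  have descent: "\<exists>w. (u, w) \<in> parcs (kite m b) \<and> kite_dist m u v = Suc (kite_dist m w v)"
    if "u \<in> pverts (kite m b)" "v \<in> pverts (kite m b)" "u \<noteq> v" for u v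
  proof -
    consider "min u m \<le> Suc (min v m)" "min v m \<le> Suc (min u m)"
      | "min u m + 2 \<le> min v m" | "min v m + 2 \<le> min u m"
      by linarith
    then show ?thesis
    proof cases
      case 1
      then have "min u m - min v m \<le> 1" "min v m - min u m \<le> 1" by (simp_all add: le_diff_conv)
      with 1 that show ?thesis
        by (intro exI[of _ v]) (simp add: kite_def kite_dist_def)
    next
      case 2
      with that \<open>m < b\<close> show ?thesis
        by (intro exI[of _ "Suc u"]) (auto simp: kite_def kite_dist_def)
    next
      case 3
      with that \<open>m < b\<close> show ?thesis
        \<comment> \<open>Not \<open>u - 1\<close>: a twin above \<open>m\<close> must leave the
          clique at once.\<close>
        by (intro exI[of _ "min u m - 1"]) (auto simp: kite_def kite_dist_def)
    qed
  qed
  show "\<exists>p. apath i p j" "graph_dist (kite m b) i j = kite_dist m i j"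
    using graph_dist_eqI[of "kite_dist m" i j] refl arc descent assms by auto
qed

lemma connected_kite:
  assumes "m < b"
  shows "Digraph_Component.connected (with_proj (kite m b))"
proof -
  interpret pair_graph "kite m b" by (rule pair_graph_kite)
  have "i \<rightarrow>\<^sup>*\<^bsub>with_proj (kite m b)\<^esub> j" if "i < b" "j < b" for i j
    using kite_apath[OF that assms] by (simp add: reachable_apath)
  then show ?thesis
    using assms by (intro connectedI) (auto intro!: reachable_mk_symmetricI)
qed

lemma explorer_guarantees_kite:
  assumes m: "0 < m" "m < b" and v: "v < b"
  shows "explorer_guarantees (kite m b) v (Suc m)"
proof -
  define missing where "missing h = {..m} - (\<lambda>i. min i m) ` set h" for h
  \<comment> \<open>From 0 a positive distance determines the position on the path, so an unvisited
    one can be forced. Elsewhere the eccentricity is named. The value 0 is a legal default once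
    every position has been visited.\<close>
  define \<sigma> where "\<sigma> h =
    (if missing h = {} then 0
     else if last h = 0 then Min (missing h)
     else max (min (last h) m) (m - min (last h) m))" for h
  \<comment> \<open>While more is to be visited, the token goes from the interior to an end and from
    the twins to 0, so \<open>rank\<close> falls until 0 is reached.\<close>
  define rank where "rank i = (if i = 0 then 0 else if m \<le> i then 1 else 2 :: nat)" for i
  have [simp]: "finite (missing h)" for h by (simp add: missing_def)
  show ?thesis
  proof (rule explorer_guaranteesI)
    show "explorer_strategy (kite m b) \<sigma>"
      unfolding explorer_strategy_def
    proof (intro allI impI)
      fix h assume "h \<noteq> [] \<and> set h \<subseteq> pverts (kite m b)"
      then have last: "last h < b" using last_in_set by fastforce
      have "\<exists>u < b. kite_dist m (last h) u = \<sigma> h"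
      proof (cases "missing h = {}")
        case True
        then show ?thesis using last by (auto simp: \<sigma>_def kite_dist_def)
      next
        case False
        define y where "y = Min (missing h)"
        have "y \<in> missing h" using False by (simp add: y_def)
        then have "y \<le> m" by (simp add: missing_def)
        define u where "u = (if last h = 0 then y
          else if m - min (last h) m \<le> min (last h) m then 0 else m)"
        have "\<sigma> h = (if last h = 0 then y else max (min (last h) m) (m - min (last h) m))"
          using False by (simp add: \<sigma>_def y_def)
        then have "u < b" "kite_dist m (last h) u = \<sigma> h"
          using \<open>y \<le> m\<close> m by (auto simp: u_def kite_dist_def)
        then show ?thesis by blast
      qed
      then show "\<exists>u \<in> pverts (kite m b). graph_dist (kite m b) (last h) u = \<sigma> h"
        using graph_dist_kite[OF last _ m(2)] by auto
    qed
    show "v \<in> pverts (kite m b)" using v by simp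
  next
    fix h u
    assume h: "h \<noteq> []" "set h \<subseteq> pverts (kite m b)" and u: "u \<in> pverts (kite m b)"
      and "graph_dist (kite m b) (last h) u = \<sigma> h" and few: "card (set (h @ [u])) < Suc m"
    define x where "x = last h"
    have x: "x \<in> set h" using h by (simp add: x_def)
    have "x < b" "u < b" using x h u by auto
    then have dist: "kite_dist m x u = \<sigma> h"
      using \<open>graph_dist _ _ _ = _\<close> graph_dist_kite m by (simp add: x_def)
    have "card (set h) \<le> card (set (h @ [u]))" by (intro card_mono) auto
    \<comment> \<open>At most \<open>m\<close> visited vertices cannot cover the
      \<open>m + 1\<close> positions, so the default branch of \<open>\<sigma>\<close> does not
      apply.\<close>
    then have "card ((\<lambda>i. min i m) ` set h) < card {..m}"
      using few card_image_le[of "set h" "\<lambda>i. min i m"] by simp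
    then have nonempty: "missing h \<noteq> {}"
      unfolding missing_def by (metis Diff_eq_empty_iff List.finite_set card_mono finite_imageI not_le)
    have missing_snoc: "missing (h @ [u]) = missing h - {min u m}" by (auto simp: missing_def)
    have mono: "card (missing (h @ [u])) \<le> card (missing h)"
      unfolding missing_snoc by (intro card_mono) auto
    \<comment> \<open>The weight 3 exceeds the largest rank, so visiting a new position pays for any
      rise of \<open>rank\<close>.\<close>
    show "3 * card (missing (h @ [u])) + rank (last (h @ [u])) < 3 * card (missing h) + rank (last h)"
    proof (cases "x = 0")
      case True
      define y where "y = Min (missing h)"
      have y: "y \<in> missing h" using nonempty by (simp add: y_def)
      then have "y \<le> m" "y \<noteq> 0" using x True by (auto simp: missing_def image_iff)
      have "min u m = y"
        using dist nonempty True \<open>y \<noteq> 0\<close> m by (auto simp: \<sigma>_def kite_dist_def y_def x_def split: if_splits)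
      then have "card (missing (h @ [u])) < card (missing h)"
        using y unfolding missing_snoc by (intro psubset_card_mono) auto
      moreover have "rank u \<le> 2" by (simp add: rank_def)
      ultimately show ?thesis by simp
    next
      case False
      have e: "kite_dist m x u = max (min x m) (m - min x m)"
        using dist nonempty False by (simp add: \<sigma>_def x_def)
      then have "x \<noteq> u" using False m by (auto simp: kite_dist_def)
      \<comment> \<open>For \<open>m = 1\<close> the Director could move between twins forever, but
        then two vertices are visited already, which is the goal.\<close>
      then have "card {x, u} \<le> card (set (h @ [u]))" using x by (intro card_mono) auto
      then have "2 \<le> m" using few \<open>x \<noteq> u\<close> by simp
      have "u = 0 \<or> m \<le> u \<and> x < m"
      proof (cases "m \<le> x")
        case True
        then have "max 1 (m - min u m) = m"
          using e \<open>x \<noteq> u\<close> by (simp add: kite_dist_def)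
        then show ?thesis using \<open>2 \<le> m\<close> by linarith
      next
        case x_less: False
        show ?thesis
        proof (rule ccontr)
          assume "\<not> ?thesis"
          then have "0 < u" "u < m" using x_less by auto
          then have "max 1 (max (x - u) (u - x)) = max x (m - x)"
            using e \<open>x \<noteq> u\<close> x_less by (simp add: kite_dist_def)
          then show False
            using \<open>0 < u\<close> \<open>u < m\<close> \<open>x \<noteq> u\<close> False x_less by linarith
        qed
      qed
      then have "rank u < rank x" using False m by (auto simp: rank_def)
      then show ?thesis using mono by (simp add: x_def)
    qed
  qed
qed

lemma explorer_guarantees_kite_le:
  assumes m: "0 < m" "m < b" and v: "v < b" and guar: "explorer_guarantees (kite m b) v k"
  shows "k \<le> Suc m"
proof -
  \<comment> \<open>The path with a single twin: the start \<open>v\<close> if it is one, otherwise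
    \<open>m\<close>.\<close>
  define S where "S = insert (max v m) {..<m}"
  have "k \<le> card S"
  proof (rule explorer_guarantees_le_card[OF guar])
    show "finite S" "S \<subseteq> pverts (kite m b)" "v \<in> S" using m v by (auto simp: S_def)
  next
    fix s u assume s: "s \<in> S" and u: "u \<in> pverts (kite m b)"
    have "\<exists>u' \<in> S. kite_dist m s u' = kite_dist m s u"
    proof (cases "u \<in> S")
      case False
      then have "m \<le> u" "u \<noteq> s" using s by (auto simp: S_def)
      show ?thesis
      proof (cases "s < m")
        case True
        with \<open>m \<le> u\<close> show ?thesis
          by (intro bexI[of _ "max v m"]) (auto simp: S_def kite_dist_def)
      next
        case False
        with \<open>m \<le> u\<close> \<open>u \<noteq> s\<close> m show ?thesis
          \<comment> \<open>Here \<open>s\<close> and \<open>u\<close> are distinct twins at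
            distance 1, and the path neighbour \<open>m - 1\<close> answers that distance within
            \<open>S\<close>.\<close>
          by (intro bexI[of _ "m - 1"]) (auto simp: S_def kite_dist_def)
      qed
    qed blast
    moreover have "S \<subseteq> {..<b}" using m v by (auto simp: S_def)
    ultimately show "\<exists>u' \<in> S. graph_dist (kite m b) s u' = graph_dist (kite m b) s u"
      using s u m graph_dist_kite by (metis lessThan_iff pverts_kite subsetD)
  qed
  also have "card S = Suc m" by (simp add: S_def)
  finally show ?thesis .
qed

theorem corollary1p1:
  fixes b k :: nat
  assumes "2 \<le> b" and "2 \<le> k" and "k \<le> b"
  shows "\<exists>G :: nat pair_pre_digraph.
           pair_graph G \<and> Digraph_Component.connected (with_proj G) \<and> card (pverts G) = b \<and>
           (\<forall>v \<in> pverts G. f_d G v = k)"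
proof -
  \<comment> \<open>The path \<open>0, ..., m\<close> has \<open>k\<close> vertices, and
    \<open>m < b\<close> leaves at least one twin.\<close>
  define m where "m = k - 1"
  have m: "0 < m" "m < b" "k = Suc m" using assms by (auto simp: m_def)
  have "f_d (kite m b) v = k" if "v < b" for v
    unfolding f_d_def m(3)
    using explorer_guarantees_kite[OF m(1,2) that] explorer_guarantees_kite_le[OF m(1,2) that]
    by (intro Greatest_equality)
  then show ?thesis
    using pair_graph_kite connected_kite[OF m(2)] by (intro exI[of _ "kite m b"]) simp
qed

end
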